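(* For every integer $\gamma\geq 2$ there exists a $(2\gamma-1,\gamma)$ elementary trapping set, with normal graph the complete bipartite graph $K_{\gamma-1,\gamma}$, belonging to a variable-regular LDPC code with column weight $\gamma$ whose Tanner graph has girth $8$.
   Context: A Tanner graph is a finite simple bipartite graph with vertex classes $V$ (variable nodes) and $C$ (check nodes). The code is variable-regular with column weight $\gamma$ if every variable node has degree $\gamma$ in the Tanner graph. The girth is the length of a shortest cycle. For a nonempty subset $S\subseteq V$ with $|S|=a$, consider the subgraph of the Tanner graph induced by $S$ together with all check nodes adjacent to some element of $S$; if exactly $b$ of these check nodes have odd degree in this subgraph, it is called an $(a,b)$ trapping set of size $a$. It is an elementary trapping set (ETS) if every one of these check nodes has degree $1$ or $2$ in the subgraph (so $b$ is the number of degree-one check nodes). The normal graph of an ETS is the graph on the vertex set $S$ obtained by deleting all degree-one check nodes and replacing each degree-two check node by an edge joining its two neighbouring variable nodes. *)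

theory Defs
  imports "Graph_Theory.Kuratowski" "HOL-Library.Extended_Nat"
begin

text \<open>
  As in the library, an undirected simple graph is a symmetric loop-free digraph without
  parallel arcs. The degree of a vertex is therefore its \<^const>\<open>out_degree\<close>.
\<close>

locale tanner_graph = pair_graph T for T :: "'a pair_pre_digraph" +
  fixes V C :: "'a set"
  assumes verts_classes: "pverts T = V \<union> C"
    and disjoint_classes: "V \<inter> C = {}"
    and bipartite: "parcs T \<subseteq> V \<times> C \<union> C \<times> V"

definition variable_regular :: "'a pair_pre_digraph \<Rightarrow> 'a set \<Rightarrow> nat \<Rightarrow> bool" where
  "variable_regular T V \<gamma> \<longleftrightarrow> (\<forall>v\<in>V. out_degree (with_proj T) v = \<gamma>)"

text \<open>
  The library's cycles are directed, so \<open>u, v, u\<close> counts as a cycle of length 2 along a single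
  undirected edge. Requiring length at least 3 leaves exactly the cycles of the undirected
  simple graph. The girth of an acyclic graph is \<open>\<infinity>\<close>.
\<close>

definition girth :: "'a pair_pre_digraph \<Rightarrow> enat" where
  "girth G = (INF p \<in> {p. pre_digraph.cycle (with_proj G) p \<and> 3 \<le> length p}. enat (length p))"

definition adjacent_checks :: "'a pair_pre_digraph \<Rightarrow> 'a set \<Rightarrow> 'a set \<Rightarrow> 'a set" where
  "adjacent_checks T C S = {c \<in> C. \<exists>v\<in>S. (v, c) \<in> parcs T}"

definition subgraph_of :: "'a pair_pre_digraph \<Rightarrow> 'a set \<Rightarrow> 'a set \<Rightarrow> ('a, 'a \<times> 'a) pre_digraph" where
  "subgraph_of T C S = with_proj T \<restriction> (S \<union> adjacent_checks T C S)"

definition trapping_set ::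
    "'a pair_pre_digraph \<Rightarrow> 'a set \<Rightarrow> 'a set \<Rightarrow> nat \<Rightarrow> nat \<Rightarrow> 'a set \<Rightarrow> bool" where
  "trapping_set T V C a b S \<longleftrightarrow>
     S \<subseteq> V \<and> S \<noteq> {} \<and> card S = a \<and>
     card {c \<in> adjacent_checks T C S. odd (out_degree (subgraph_of T C S) c)} = b"

definition elementary_trapping_set ::
    "'a pair_pre_digraph \<Rightarrow> 'a set \<Rightarrow> 'a set \<Rightarrow> nat \<Rightarrow> nat \<Rightarrow> 'a set \<Rightarrow> bool" where
  "elementary_trapping_set T V C a b S \<longleftrightarrow>
     trapping_set T V C a b S \<and>
     (\<forall>c \<in> adjacent_checks T C S. out_degree (subgraph_of T C S) c \<in> {1, 2})"

text \<open>
  The edge that replaces a degree-two check \<open>c\<close> with neighbours \<open>u\<close> and \<open>v\<close> is the pair of arcs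
  \<open>(u, c, v)\<close> and \<open>(v, c, u)\<close>. Keeping \<open>c\<close> in the arc means that two checks with the same
  neighbours yield parallel edges rather than being identified.
\<close>

definition normal_graph ::
    "'a pair_pre_digraph \<Rightarrow> 'a set \<Rightarrow> 'a set \<Rightarrow> ('a, 'a \<times> 'a \<times> 'a) pre_digraph" where
  "normal_graph T C S =
     \<lparr> verts = S,
       arcs = {(u, c, v). c \<in> adjacent_checks T C S \<and> out_degree (subgraph_of T C S) c = 2 \<and>
                 u \<noteq> v \<and> (u, c) \<in> arcs (subgraph_of T C S) \<and> (c, v) \<in> arcs (subgraph_of T C S)},
       tail = (\<lambda>(u, c, v). u),
       head = (\<lambda>(u, c, v). v) \<rparr>"

end

theory Submission
  imports Defs "HOL-Library.Nat_Bijection"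
begin

text \<open>
  The Tanner graph is the subdivision of \<open>K\<^bsub>\<gamma>,\<gamma>\<^esub>\<close>: its variables are the \<open>\<gamma>\<close> rows and the \<open>\<gamma>\<close>
  columns of a grid, and the cell in row \<open>i\<close> and column \<open>j\<close> is a check joining this row to this
  column. Its cycles are the subdivided cycles of \<open>K\<^bsub>\<gamma>,\<gamma>\<^esub>\<close>, so its girth is 8. Remove one row from
  the set of variables: each of the \<open>\<gamma>\<close> cells of that row keeps one neighbour, and the other cells
  keep two, which subdivide \<open>K\<^bsub>\<gamma>-1,\<gamma>\<^esub>\<close>.
\<close>

section \<open>Cycles as non-backtracking closed walks\<close>

text \<open>Replaces the recursion of \<open>pcas\<close> by indexed access, so that arcs can later
  be addressed modulo the length.\<close>

lemma pcas_nthD: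
  assumes "pcas u p v" "p \<noteq> []"
  shows "fst (p ! 0) = u \<and> snd (p ! (length p - 1)) = v \<and>
    (\<forall>k. Suc k < length p \<longrightarrow> fst (p ! Suc k) = snd (p ! k))"
  using assms
proof (induction p arbitrary: u)
  case (Cons e p)
  show ?case
  proof (cases "p = []")
    case False
    have "fst e = u" and "pcas (snd e) p v"
      using Cons.prems(1) by (cases e; simp)+
    with Cons.IH False show ?thesis
      by (auto simp: nth_Cons split: nat.splits)
  qed (use Cons.prems in \<open>cases e; simp\<close>)
qed simp

lemma pawalk_verts_tl:
  assumes "pcas u p v"
  shows "tl (pawalk_verts u p) = map snd p"
proof -
  have "pawalk_verts u p = u # map snd p"
    using assms by (induction p arbitrary: u) auto
  then show ?thesis by simp
qed

text \<open>Unrolling a cycle into an infinite periodic walk lets later arguments start at any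
  vertex without rotating the list. Of the distinctness of the vertices, only the ban on
  backtracking is kept.\<close>

lemma (in pair_pre_digraph) cycle_periodic_walk:
  assumes "cycle p" and len: "3 \<le> length p"
  obtains f where "\<And>k. (f k, f (Suc k)) \<in> parcs G" "\<And>k. f (k + length p) = f k"
    "\<And>k. f (k + 2) \<noteq> f k"
proof -
  let ?n = "length p"
  \<comment> \<open>Heads of arcs are used because \<open>cycle\<close> demands distinctness of the
    vertex list without its first entry, which is the list of heads.\<close>
  define f where "f k = snd (p ! (k mod ?n))" for k
  obtain u where sub: "set p \<subseteq> parcs G" and cas: "pcas u p u"
    and dist: "distinct (tl (pawalk_verts u p))"
    using assms(1) by (auto simp: cycle_def awalk_def)
  have dist: "distinct (map snd p)"
    using dist pawalk_verts_tl[OF cas] by simp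
  have ne: "p \<noteq> []" using len by auto
  note nth = pcas_nthD[OF cas ne]
  have "(f k, f (Suc k)) \<in> parcs G" for k
  proof -
    have "fst (p ! (Suc k mod ?n)) = snd (p ! (k mod ?n))"
    proof (cases "Suc (k mod ?n) = ?n")
      case True
      \<comment> \<open>At the wrap-around the last arc ends in \<open>u\<close>, where the first
        one starts.\<close>
      then have "k mod ?n = ?n - 1" by simp
      with True nth show ?thesis by (simp add: mod_Suc)
    next
      case False
      then have "Suc (k mod ?n) < ?n"
        using ne by (simp add: Suc_lessI)
      with False nth show ?thesis by (simp add: mod_Suc)
    qed
    then have "(f k, f (Suc k)) = p ! (Suc k mod ?n)"
      by (simp add: f_def prod_eq_iff)
    moreover have "p ! (Suc k mod ?n) \<in> set p" using ne by simp
    ultimately show ?thesis using sub by auto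
  qed
  moreover have "f (k + ?n) = f k" for k by (simp add: f_def)
  moreover have "f (k + 2) \<noteq> f k" for k
  proof
    assume "f (k + 2) = f k"
    then have "map snd p ! ((k + 2) mod ?n) = map snd p ! (k mod ?n)"
      using ne by (simp add: f_def)
    then have "(k + 2) mod ?n = k mod ?n"
      using dist ne by (subst (asm) nth_eq_iff_index_eq) auto
    then have "?n dvd 2"
      by (simp add: mod_eq_dvd_iff_nat)
    then show False using len by (auto dest: dvd_imp_le)
  qed
  ultimately show thesis using that by blast
qed

section \<open>The grid graph\<close>

text \<open>All nodes are naturals; the residue modulo 3 tells rows, columns and cells
  apart.\<close>

definition row_node :: "nat \<Rightarrow> nat" where "row_node i = 3 * i"

definition col_node :: "nat \<Rightarrow> nat" where "col_node j = 3 * j + 1"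

definition cell_node :: "nat \<Rightarrow> nat \<Rightarrow> nat" where "cell_node i j = 3 * prod_encode (i, j) + 2"

lemma row_node_eq [simp]: "row_node i = row_node i' \<longleftrightarrow> i = i'"
  by (simp add: row_node_def)

lemma col_node_eq [simp]: "col_node i = col_node i' \<longleftrightarrow> i = i'"
  by (simp add: col_node_def)

lemma cell_node_eq [simp]: "cell_node i j = cell_node i' j' \<longleftrightarrow> i = i' \<and> j = j'"
  by (simp add: cell_node_def)

lemma node_distinct [simp]:
  "row_node i \<noteq> col_node j" "col_node j \<noteq> row_node i"
  "row_node i \<noteq> cell_node k l" "cell_node k l \<noteq> row_node i"
  "col_node j \<noteq> cell_node k l" "cell_node k l \<noteq> col_node j"
  unfolding row_node_def col_node_def cell_node_def by presburger+

text \<open>Rows and columns are counted separately so that the trapping set, which lacks a row, has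
  this form too.\<close>

definition grid_vars :: "nat \<Rightarrow> nat \<Rightarrow> nat set" where
  "grid_vars m n = row_node ` {..<m} \<union> col_node ` {..<n}"

definition grid_checks :: "nat \<Rightarrow> nat \<Rightarrow> nat set" where
  "grid_checks m n = (\<lambda>(i, j). cell_node i j) ` ({..<m} \<times> {..<n})"

definition grid_edges :: "nat \<Rightarrow> nat \<Rightarrow> (nat \<times> nat) set" where
  "grid_edges m n = (\<Union>i<m. \<Union>j<n. {(row_node i, cell_node i j), (col_node j, cell_node i j)})"

definition grid_graph :: "nat \<Rightarrow> nat \<Rightarrow> nat pair_pre_digraph" where
  "grid_graph m n =
    \<lparr> pverts = grid_vars m n \<union> grid_checks m n, parcs = grid_edges m n \<union> (grid_edges m n)\<inverse> \<rparr>"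

lemma pverts_grid [simp]: "pverts (grid_graph m n) = grid_vars m n \<union> grid_checks m n"
  by (simp add: grid_graph_def)

lemma grid_vars_iff [simp]:
  "row_node i \<in> grid_vars m n \<longleftrightarrow> i < m" "col_node j \<in> grid_vars m n \<longleftrightarrow> j < n"
  "cell_node i j \<notin> grid_vars m n"
  by (auto simp: grid_vars_def)

lemma grid_checks_iff [simp]:
  "cell_node i j \<in> grid_checks m n \<longleftrightarrow> i < m \<and> j < n"
  "row_node i \<notin> grid_checks m n" "col_node j \<notin> grid_checks m n"
  by (auto simp: grid_checks_def)

lemma grid_varsE:
  assumes "v \<in> grid_vars m n"
  obtains i where "v = row_node i" "i < m" | j where "v = col_node j" "j < n"
  using assms by (auto simp: grid_vars_def)

lemma grid_checksE:
  assumes "c \<in> grid_checks m n"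
  obtains i j where "c = cell_node i j" "i < m" "j < n"
  using assms by (auto simp: grid_checks_def)

lemma finite_grid [simp]: "finite (grid_vars m n)" "finite (grid_checks m n)"
  by (auto simp: grid_vars_def grid_checks_def)

lemma card_grid_vars: "card (grid_vars m n) = m + n"
  unfolding grid_vars_def
  by (subst card_Un_disjoint) (auto simp: card_image inj_on_def)

lemma row_arc_iff: "(row_node i, w) \<in> parcs (grid_graph m n) \<longleftrightarrow> (\<exists>j<n. w = cell_node i j \<and> i < m)"
  by (auto simp: grid_graph_def grid_edges_def)

lemma col_arc_iff: "(col_node j, w) \<in> parcs (grid_graph m n) \<longleftrightarrow> (\<exists>i<m. w = cell_node i j \<and> j < n)"
  by (auto simp: grid_graph_def grid_edges_def)

lemma cell_arc_iff:
  "(cell_node i j, w) \<in> parcs (grid_graph m n) \<longleftrightarrow> i < m \<and> j < n \<and> (w = row_node i \<or> w = col_node j)"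
  by (auto simp: grid_graph_def grid_edges_def)

lemmas grid_arc_iffs = row_arc_iff col_arc_iff cell_arc_iff

lemma grid_arc_sym: "(u, v) \<in> parcs (grid_graph m n) \<Longrightarrow> (v, u) \<in> parcs (grid_graph m n)"
  by (auto simp: grid_graph_def)

lemma grid_arcs_subset:
  "parcs (grid_graph m n) \<subseteq>
    grid_vars m n \<times> grid_checks m n \<union> grid_checks m n \<times> grid_vars m n"
  by (auto simp: grid_graph_def grid_edges_def)

lemma grid_vars_checks_disjoint: "grid_vars m n \<inter> grid_checks m n = {}"
  by (auto elim: grid_varsE)

lemma tanner_graph_grid: "tanner_graph (grid_graph m n) (grid_vars m n) (grid_checks m n)"
proof
  fix e assume "e \<in> parcs (grid_graph m n)"
  then have "e \<in> grid_vars m n \<times> grid_checks m n \<union> grid_checks m n \<times> grid_vars m n"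
    using grid_arcs_subset by blast
  then show "fst e \<in> pverts (grid_graph m n)" "snd e \<in> pverts (grid_graph m n)" "fst e \<noteq> snd e"
    using grid_vars_checks_disjoint[of m n] by auto
next
  show "finite (parcs (grid_graph m n))"
    by (rule finite_subset[OF grid_arcs_subset]) simp
  show "symmetric (grid_graph m n)"
    by (auto simp: symmetric_def intro!: symI grid_arc_sym)
qed (use grid_arcs_subset grid_vars_checks_disjoint in auto)

text \<open>A row has one cell per column and a column one cell per row; in a square grid these
  counts agree.\<close>

lemma out_degree_grid:
  assumes "v \<in> grid_vars g g"
  shows "out_degree (with_proj (grid_graph g g)) v = g"
  using assms
proof (cases rule: grid_varsE)
  case (1 i)
  then have "out_arcs (with_proj (grid_graph g g)) v = (\<lambda>j. (row_node i, cell_node i j)) ` {..<g}"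
    by (auto simp: out_arcs_def row_arc_iff)
  then show ?thesis by (simp add: out_degree_def card_image inj_on_def)
next
  case (2 j)
  then have "out_arcs (with_proj (grid_graph g g)) v = (\<lambda>i. (col_node j, cell_node i j)) ` {..<g}"
    by (auto simp: out_arcs_def col_arc_iff)
  then show ?thesis by (simp add: out_degree_def card_image inj_on_def)
qed

section \<open>Girth\<close>

text \<open>A cell has just two neighbours, so a walk that cannot turn back crosses it from row to
  column or from column to row. The two cells visited share column \<open>j\<close> and differ,
  hence lie in different rows.\<close>

lemma grid_walk_from_row:
  assumes arc: "\<And>k. (f k, f (Suc k)) \<in> parcs (grid_graph m n)"
    and nb: "\<And>k. f (k + 2) \<noteq> f k"
    and row: "f k = row_node i"
  obtains j i' where "f (k + 1) = cell_node i j" "f (k + 2) = col_node j"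
    "f (k + 3) = cell_node i' j" "f (k + 4) = row_node i'" "i' \<noteq> i"
proof -
  obtain j where 1: "f (k + 1) = cell_node i j"
    using arc[of k] by (auto simp: row row_arc_iff)
  have 2: "f (k + 2) = col_node j"
    using arc[of "k + 1"] nb[of k] 1 row by (auto simp: cell_arc_iff)
  obtain i' where 3: "f (k + 3) = cell_node i' j"
    using arc[of "k + 2"] 2 by (auto simp: col_arc_iff eval_nat_numeral)
  have 4: "f (k + 4) = row_node i'"
    using arc[of "k + 3"] nb[of "k + 2"] 2 3 by (auto simp: cell_arc_iff eval_nat_numeral)
  have "i' \<noteq> i"
    using nb[of "k + 1"] 1 3 by (auto simp: eval_nat_numeral)
  with 1 2 3 4 show thesis by (rule that)
qed

text \<open>One of the first two vertices is a variable; if it is a column, the walk reaches a row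
  two steps later.\<close>

lemma grid_walk_visits_row:
  assumes arc: "\<And>k. (f k, f (Suc k)) \<in> parcs (grid_graph m n)"
    and nb: "\<And>k. f (k + 2) \<noteq> f k"
  obtains k i where "f k = row_node i"
proof -
  have from_col: thesis if col: "f k = col_node j" for k j
  proof -
    obtain i where i: "f (Suc k) = cell_node i j"
      using arc[of k] col by (auto simp: col_arc_iff)
    then have "f (Suc (Suc k)) = row_node i"
      using arc[of "Suc k"] nb[of k] col by (auto simp: cell_arc_iff)
    then show thesis by (rule \<open>\<And>k i. f k = row_node i \<Longrightarrow> thesis\<close>)
  qed
  have "f 0 \<in> grid_vars m n \<or> f (Suc 0) \<in> grid_vars m n"
    using arc[of 0] grid_arcs_subset by blast
  then show thesis
    using from_col that by (auto elim!: grid_varsE)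
qed

lemma grid_cycle_length_ge:
  assumes "pre_digraph.cycle (with_proj (grid_graph m n)) p" and "3 \<le> length p"
  shows "8 \<le> length p"
proof -
  obtain f where arc: "\<And>k. (f k, f (Suc k)) \<in> parcs (grid_graph m n)"
    and per: "\<And>k. f (k + length p) = f k" and nb: "\<And>k. f (k + 2) \<noteq> f k"
    using pair_pre_digraph.cycle_periodic_walk[OF assms] by blast
  obtain k i where row: "f k = row_node i"
    using grid_walk_visits_row[OF arc nb] by blast
  obtain j i' where w: "f (k + 1) = cell_node i j" "f (k + 2) = col_node j"
    "f (k + 3) = cell_node i' j" "f (k + 4) = row_node i'" "i' \<noteq> i"
    using grid_walk_from_row[OF arc nb row] by blast
  obtain j' i'' where w': "f (k + 4 + 1) = cell_node i' j'" "f (k + 4 + 2) = col_node j'"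
    "f (k + 4 + 3) = cell_node i'' j'"
    using grid_walk_from_row[OF arc nb w(4)] by blast
  \<comment> \<open>By periodicity \<open>row_node i\<close> recurs after \<open>length p\<close>
    steps, but the vertices 3 to 7 steps on are cells, columns or the other row
    \<open>i'\<close>.\<close>
  have "length p \<notin> {3, 4, 5, 6, 7}"
    using per[of k] row w w' by (auto simp: ac_simps)
  with assms(2) show ?thesis by simp
qed

lemma girth_grid:
  assumes "2 \<le> m" "2 \<le> n"
  shows "girth (grid_graph m n) = 8"
proof (rule antisym)
  \<comment> \<open>The subdivided 4-cycle through rows 0, 1 and columns 0, 1.\<close>
  define p where "p =
    [(row_node 0, cell_node 0 0), (cell_node 0 0, col_node 0),
     (col_node 0, cell_node 1 0), (cell_node 1 0, row_node 1),
     (row_node 1, cell_node 1 1), (cell_node 1 1, col_node 1),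
     (col_node 1, cell_node 0 1), (cell_node 0 1, row_node 0)]"
  have "pre_digraph.awalk (with_proj (grid_graph m n)) (row_node 0) p (row_node 0)"
    using assms by (simp add: pre_digraph.awalk_def cas_with_proj_eq p_def grid_arc_iffs)
  then have "pre_digraph.cycle (with_proj (grid_graph m n)) p"
    unfolding pre_digraph.cycle_def
    by (intro exI[of _ "row_node 0"]) (simp add: awalk_verts_with_proj_eq p_def)
  moreover have "length p = 8" by (simp add: p_def)
  ultimately show "girth (grid_graph m n) \<le> 8"
    unfolding girth_def by (intro INF_lower2[of p]) (auto simp: numeral_eq_enat)
next
  show "8 \<le> girth (grid_graph m n)"
    unfolding girth_def
    by (intro INF_greatest) (auto dest: grid_cycle_length_ge simp: numeral_eq_enat)
qed

section \<open>The trapping set\<close>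

text \<open>The columns alone already reach every cell, whatever the number \<open>k\<close> of rows
  kept.\<close>

lemma adjacent_checks_grid:
  "0 < n \<Longrightarrow>
    adjacent_checks (grid_graph m n) (grid_checks m n) (grid_vars k n) = grid_checks m n"
  by (auto simp: adjacent_checks_def elim!: grid_checksE
      intro!: bexI[of _ "col_node j" for j] simp: col_arc_iff)

lemma arcs_subgraph_grid:
  assumes "0 < n"
  shows "e \<in> arcs (subgraph_of (grid_graph m n) (grid_checks m n) (grid_vars k n)) \<longleftrightarrow>
    e \<in> parcs (grid_graph m n) \<and> fst e \<in> grid_vars k n \<union> grid_checks m n \<and>
      snd e \<in> grid_vars k n \<union> grid_checks m n"
  using assms by (simp add: subgraph_of_def adjacent_checks_grid)

text \<open>The column of a cell always survives, its row only if it is among the first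
  \<open>k\<close>.\<close>

lemma out_degree_subgraph_grid:
  assumes "i < m" "j < n"
  shows "out_degree (subgraph_of (grid_graph m n) (grid_checks m n) (grid_vars k n)) (cell_node i j)
    = (if i < k then 2 else 1)"
proof -
  have "0 < n" using assms by simp
  have "tail (subgraph_of (grid_graph m n) (grid_checks m n) (grid_vars k n)) = fst"
    by (simp add: subgraph_of_def)
  then have "out_arcs (subgraph_of (grid_graph m n) (grid_checks m n) (grid_vars k n)) (cell_node i j)
    = (if i < k then {(cell_node i j, row_node i), (cell_node i j, col_node j)}
       else {(cell_node i j, col_node j)})"
    using assms by (auto simp: out_arcs_def arcs_subgraph_grid[OF \<open>0 < n\<close>] cell_arc_iff)
  then show ?thesis by (simp add: out_degree_def)
qed

text \<open>The checks of odd degree are the cells of the \<open>m - k\<close> removed rows,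
  \<open>n\<close> in each.\<close>

lemma elementary_trapping_set_grid:
  assumes "0 < n" and km: "k \<le> m"
  shows "elementary_trapping_set (grid_graph m n) (grid_vars m n) (grid_checks m n)
    (k + n) ((m - k) * n) (grid_vars k n)"
proof -
  let ?deg = "out_degree (subgraph_of (grid_graph m n) (grid_checks m n) (grid_vars k n))"
  have "{c \<in> grid_checks m n. odd (?deg c)} = (\<lambda>(i, j). cell_node i j) ` ({k..<m} \<times> {..<n})"
    by (force elim!: grid_checksE simp: out_degree_subgraph_grid split: if_splits)
  moreover have "card \<dots> = (m - k) * n"
    by (subst card_image) (auto simp: inj_on_def card_cartesian_product)
  moreover have "grid_vars k n \<subseteq> grid_vars m n"
    using km by (auto elim!: grid_varsE)
  moreover have "grid_vars k n \<noteq> {}"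
    using assms by (auto simp: grid_vars_def)
  moreover have "\<forall>c \<in> grid_checks m n. ?deg c \<in> {1, 2}"
    by (auto elim!: grid_checksE simp: out_degree_subgraph_grid)
  ultimately show ?thesis
    using assms
    by (auto simp: elementary_trapping_set_def trapping_set_def adjacent_checks_grid card_grid_vars)
qed

lemma arcs_normal_graph_grid:
  assumes "0 < n" and "k \<le> m"
  shows "arcs (normal_graph (grid_graph m n) (grid_checks m n) (grid_vars k n)) =
    (\<Union>i<k. \<Union>j<n. {(row_node i, cell_node i j, col_node j), (col_node j, cell_node i j, row_node i)})"
    (is "?L = ?R")
proof
  show "?L \<subseteq> ?R"
  proof
    fix e assume "e \<in> ?L"
    then obtain u c v where e: "e = (u, c, v)" and c: "c \<in> grid_checks m n"
      and deg: "out_degree (subgraph_of (grid_graph m n) (grid_checks m n) (grid_vars k n)) c = 2"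
      and "u \<noteq> v" "(u, c) \<in> parcs (grid_graph m n)" and cv: "(c, v) \<in> parcs (grid_graph m n)"
      using assms by (auto simp: normal_graph_def adjacent_checks_grid arcs_subgraph_grid)
    \<comment> \<open>Both ends are now neighbours of \<open>c\<close>; being distinct, they are its
      row and its column.\<close>
    then have cu: "(c, u) \<in> parcs (grid_graph m n)" by (simp add: grid_arc_sym)
    obtain i j where ij: "c = cell_node i j" "i < m" "j < n"
      using c by (rule grid_checksE)
    then have "i < k" using deg by (auto simp: out_degree_subgraph_grid split: if_splits)
    with ij cu cv \<open>u \<noteq> v\<close> show "e \<in> ?R" by (auto simp: e cell_arc_iff)
  qed
  show "?R \<subseteq> ?L"
    using assms
    by (auto simp: normal_graph_def adjacent_checks_grid arcs_subgraph_grid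
        out_degree_subgraph_grid grid_arc_iffs)
qed

lemma complete_bipartite_normal_graph_grid:
  assumes "0 < n" and "k \<le> m"
  shows "complete_bipartite_digraph k n
    (normal_graph (grid_graph m n) (grid_checks m n) (grid_vars k n))"
    (is "complete_bipartite_digraph k n ?N")
proof -
  have verts: "verts ?N = row_node ` {..<k} \<union> col_node ` {..<n}"
    and th: "tail ?N = (\<lambda>(u, c, v). u)" "head ?N = (\<lambda>(u, c, v). v)"
    by (simp_all add: normal_graph_def grid_vars_def)
  note arcs = arcs_normal_graph_grid[OF assms]
  have ends: "arcs_ends ?N = row_node ` {..<k} \<times> col_node ` {..<n} \<union>
      col_node ` {..<n} \<times> row_node ` {..<k}"
    unfolding arcs_ends_conv arcs th by (force simp: image_iff)
  have "graph ?N"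
  proof
    show "symmetric ?N"
      unfolding symmetric_def ends by (auto intro: symI)
    show "finite (verts ?N)" "finite (arcs ?N)"
      by (simp_all add: verts arcs)
  \<comment> \<open>There are no parallel arcs because a row and a column determine the cell between
    them.\<close>
  qed (auto simp: verts arcs th arc_to_ends_def)
  then show ?thesis
    unfolding complete_bipartite_digraph_def
    using verts ends
    by (intro conjI exI[of _ "row_node ` {..<k}"] exI[of _ "col_node ` {..<n}"])
      (auto simp: card_image inj_on_def)
qed

theorem mainTheorem3:
  fixes \<gamma> :: nat
  assumes "\<gamma> \<ge> 2"
  shows "\<exists>(T :: nat pair_pre_digraph) V C S.
           tanner_graph T V C \<and> variable_regular T V \<gamma> \<and> girth T = 8 \<and>
           elementary_trapping_set T V C (2 * \<gamma> - 1) \<gamma> S \<and>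
           complete_bipartite_digraph (\<gamma> - 1) \<gamma> (normal_graph T C S)"
proof (intro exI conjI)
  show "tanner_graph (grid_graph \<gamma> \<gamma>) (grid_vars \<gamma> \<gamma>) (grid_checks \<gamma> \<gamma>)"
    by (rule tanner_graph_grid)
  show "variable_regular (grid_graph \<gamma> \<gamma>) (grid_vars \<gamma> \<gamma>) \<gamma>"
    by (simp add: variable_regular_def out_degree_grid)
  show "girth (grid_graph \<gamma> \<gamma>) = 8"
    using assms by (simp add: girth_grid)
  \<comment> \<open>The parameters for \<open>k = \<gamma> - 1\<close>: the single removed row
    yields all \<gamma> checks of degree one.\<close>
  have "\<gamma> - 1 + \<gamma> = 2 * \<gamma> - 1" "(\<gamma> - (\<gamma> - 1)) * \<gamma> = \<gamma>"
    using assms by simp_all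
  then show "elementary_trapping_set (grid_graph \<gamma> \<gamma>) (grid_vars \<gamma> \<gamma>) (grid_checks \<gamma> \<gamma>)
      (2 * \<gamma> - 1) \<gamma> (grid_vars (\<gamma> - 1) \<gamma>)"
    using elementary_trapping_set_grid[where k = "\<gamma> - 1" and m = \<gamma> and n = \<gamma>] assms by simp
  show "complete_bipartite_digraph (\<gamma> - 1) \<gamma>
      (normal_graph (grid_graph \<gamma> \<gamma>) (grid_checks \<gamma> \<gamma>) (grid_vars (\<gamma> - 1) \<gamma>))"
    using assms by (simp add: complete_bipartite_normal_graph_grid)
qed

end
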